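(* Let $(x^k,\lambda^k)_{k\ge 1}$ and $(\beta_k)_{k\ge1}$ be generated by the IADMM algorithm described in the context, and let $x^*=(y^*,z^* )$ be the primal part of a KKT solution $(x^*,\lambda^* )$ of the problem $\min\{f(y)+g(z) : By+Cz=b\}$. Define $\gamma_k:=\sum_{i=1}^k\beta_i$ and $v^k:=\frac{\sum_{i=1}^{k}\beta_i x^{i+1}}{\sum_{i=1}^k\beta_i}$. Then, as $k\to\infty$, $$|\mathcal F(v^k)-\mathcal F(x^* )|=O(1/\gamma_k),\qquad \|\mathcal A v^k-b\|=O(1/\gamma_k).$$
   Context: Problem: $\min\{f(y)+g(z): By+Cz=b\}$, where $B\in\mathbb R^{m\times n_1}$, $C\in\mathbb R^{m\times n_2}$, $b\in\mathbb R^m$, and $f:\mathbb R^{n_1}\to(-\infty,\infty]$, $g:\mathbb R^{n_2}\to(-\infty,\infty]$ are proper, lower semicontinuous and convex. There is $\sigma_g\ge 0$ such that $g(x)-g(y)\ge\langle\xi,x-y\rangle+\frac{\sigma_g}{2}\|x-y\|^2$ for all $x,y\in\mathbb R^{n_2}$ and all $\xi\in\partial g(y)$ (when $\sigma_g>0$ the function $g$ is strongly convex and the problem is called semi-strongly convex). Notation: $x=(y,z)$, $\mathcal F(x)=f(y)+g(z)$, $\mathcal A x=By+Cz$, $\|\cdot\|$ is the Euclidean norm. A triple $(y,z,\lambda)$ is a KKT solution if $0\in\partial f(y)+B^\top\lambda$, $0\in\partial g(z)+C^\top\lambda$ and $By+Cz-b=0$. The set of KKT solutions is assumed nonempty. For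 a symmetric positive semidefinite matrix $D$, $\|w\|_D=\sqrt{\langle w,Dw\rangle}$; $\succeq,\preceq$ denote the Loewner order. IADMM algorithm: choose $x^1=(y^1,z^1)$, $\lambda^1$, constants $\gamma\in(1,\frac{1+\sqrt5}{2})$ and $\epsilon,\beta,\tau\in(0,1)$, an initial penalty $\beta_1\in[\beta,\infty)$, a symmetric matrix $Q\succeq0$, and symmetric matrices $P_k\succeq0$ $(k\ge1)$ with $\beta_{k+1}P_{k+1}\preceq\beta_kP_k$ for all $k\ge1$; set $Q_k=\beta_kQ$. It is assumed that $\lambda_{\max}(C^\top C+Q)>0$. For $k=1,2,\dots$: 1. $y^{k+1}\in\arg\min_y\{f(y)+\langle\lambda^k,By\rangle+\frac{\beta_k}{2}\|By+Cz^k-b\|^2+\frac12\|y-y^k\|^2_{P_k}\}$; 2. $z^{k+1}\in\arg\min_z\{g(z)+\langle\lambda^k,Cz\rangle+\frac{\beta_k}{2}\|By^{k+1}+Cz-b\|^2+\frac12\|z-z^k\|^2_{Q_k}\}$; 3. $\lambda^{k+1}=\lambda^k+\gamma\beta_k(By^{k+1}+Cz^{k+1}-b)$; 4. choose any $\beta_{k+1}\in\left[\max\{\beta,\tau\beta_k\},\ \sqrt{\beta_k^2+\frac{(1-\epsilon)\sigma_g\beta_k}{\lambda_{\max}(C^\top C+Q)}}\right]$. Every subproblem is assumed to be well-defined with an optimal solution. *)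

theory Defs
  imports "HOL-Analysis.Analysis" "HOL-Library.Landau_Symbols"
begin

section \<open>Extended-valued convex functions\<close>

text \<open>Functions into \<open>(-\<infinity>, \<infinity>]\<close> are modelled as \<^typ>\<open>ereal\<close>-valued functions; properness
  excludes the value \<open>-\<infinity>\<close>.\<close>

definition proper_fun :: "('a \<Rightarrow> ereal) \<Rightarrow> bool"
  where "proper_fun f \<longleftrightarrow> (\<forall>x. f x \<noteq> -\<infinity>) \<and> (\<exists>x. f x \<noteq> \<infinity>)"

definition lsc_fun :: "('a::topological_space \<Rightarrow> ereal) \<Rightarrow> bool"
  where "lsc_fun f \<longleftrightarrow> (\<forall>x. f x \<le> Liminf (at x) f)"

text \<open>Only meaningful for functions that avoid \<open>-\<infinity>\<close>. The convention \<open>0 * \<infinity> = 0\<close> of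
  \<^typ>\<open>ereal\<close> makes the endpoint cases of the inequality trivial.\<close>

definition convex_fun :: "('a::real_vector \<Rightarrow> ereal) \<Rightarrow> bool"
  where "convex_fun f \<longleftrightarrow>
    (\<forall>x y. \<forall>u\<ge>0. \<forall>v\<ge>0. u + v = 1 \<longrightarrow>
       f (u *\<^sub>R x + v *\<^sub>R y) \<le> ereal u * f x + ereal v * f y)"

text \<open>For proper \<open>f\<close> this set is empty wherever \<open>f y = \<infinity>\<close>.\<close>

definition subdifferential :: "('a::real_inner \<Rightarrow> ereal) \<Rightarrow> 'a \<Rightarrow> 'a set"
  where "subdifferential f y = {\<xi>. \<forall>x. f x \<ge> f y + ereal (\<xi> \<bullet> (x - y))}"

section \<open>Symmetric matrices\<close>

definition psd :: "real^'n^'n \<Rightarrow> bool"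
  where "psd D \<longleftrightarrow> transpose D = D \<and> (\<forall>w. 0 \<le> w \<bullet> (D *v w))"

definition loewner_le :: "real^'n^'n \<Rightarrow> real^'n^'n \<Rightarrow> bool"
  where "loewner_le D E \<longleftrightarrow> psd (E - D)"

definition wnorm :: "real^'n^'n \<Rightarrow> real^'n \<Rightarrow> real"
  where "wnorm D w = sqrt (w \<bullet> (D *v w))"

text \<open>Largest real eigenvalue; used only for symmetric matrices, whose set of eigenvalues is
  finite, nonempty and real.\<close>

definition lambda_max :: "real^'n^'n \<Rightarrow> real"
  where "lambda_max M = Max {e. \<exists>v. v \<noteq> 0 \<and> M *v v = e *\<^sub>R v}"

section \<open>The linearly constrained problem\<close>

definition total_obj ::
  "(real^'n1 \<Rightarrow> ereal) \<Rightarrow> (real^'n2 \<Rightarrow> ereal) \<Rightarrow> (real^'n1) \<times> (real^'n2) \<Rightarrow> ereal"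
  where "total_obj f g x = f (fst x) + g (snd x)"

definition constr_map ::
  "real^'n1^'m \<Rightarrow> real^'n2^'m \<Rightarrow> (real^'n1) \<times> (real^'n2) \<Rightarrow> real^'m"
  where "constr_map B C x = B *v fst x + C *v snd x"

definition kkt_solution ::
  "(real^'n1 \<Rightarrow> ereal) \<Rightarrow> (real^'n2 \<Rightarrow> ereal) \<Rightarrow> real^'n1^'m \<Rightarrow> real^'n2^'m \<Rightarrow> real^'m
    \<Rightarrow> real^'n1 \<Rightarrow> real^'n2 \<Rightarrow> real^'m \<Rightarrow> bool"
  where "kkt_solution f g B C b y z l \<longleftrightarrow>
    0 \<in> (\<lambda>\<xi>. \<xi> + transpose B *v l) ` subdifferential f y \<and>
    0 \<in> (\<lambda>\<xi>. \<xi> + transpose C *v l) ` subdifferential g z \<and>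
    B *v y + C *v z - b = 0"

section \<open>Subproblems of the algorithm and ergodic averages\<close>

text \<open>In \<open>y_obj\<close>, \<open>bk\<close> is the current penalty, \<open>D\<close> the proximal matrix \<open>P\<^sub>k\<close>, and
  \<open>(yk, zk, lk)\<close> the current iterate. In \<open>z_obj\<close>, \<open>D\<close> is \<open>Q\<^sub>k\<close> and \<open>ynew\<close> is
  the already updated first block.\<close>

definition y_obj ::
  "(real^'n1 \<Rightarrow> ereal) \<Rightarrow> real^'n1^'m \<Rightarrow> real^'n2^'m \<Rightarrow> real^'m \<Rightarrow> real \<Rightarrow> real^'n1^'n1
    \<Rightarrow> real^'n1 \<Rightarrow> real^'n2 \<Rightarrow> real^'m \<Rightarrow> real^'n1 \<Rightarrow> ereal"
  where "y_obj f B C b bk D yk zk lk y =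
    f y + ereal (lk \<bullet> (B *v y) + bk / 2 * (norm (B *v y + C *v zk - b))\<^sup>2
                 + 1 / 2 * (wnorm D (y - yk))\<^sup>2)"

definition z_obj ::
  "(real^'n2 \<Rightarrow> ereal) \<Rightarrow> real^'n1^'m \<Rightarrow> real^'n2^'m \<Rightarrow> real^'m \<Rightarrow> real \<Rightarrow> real^'n2^'n2
    \<Rightarrow> real^'n1 \<Rightarrow> real^'n2 \<Rightarrow> real^'m \<Rightarrow> real^'n2 \<Rightarrow> ereal"
  where "z_obj g B C b bk D ynew zk lk z =
    g z + ereal (lk \<bullet> (C *v z) + bk / 2 * (norm (B *v ynew + C *v z - b))\<^sup>2
                 + 1 / 2 * (wnorm D (z - zk))\<^sup>2)"

text \<open>All sequences are indexed from 1; their values at index 0 play no role.\<close>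

definition penalty_sum :: "(nat \<Rightarrow> real) \<Rightarrow> nat \<Rightarrow> real"
  where "penalty_sum bet k = (\<Sum>i=1..k. bet i)"

definition ergodic_avg :: "(nat \<Rightarrow> real) \<Rightarrow> (nat \<Rightarrow> 'a::real_vector) \<Rightarrow> nat \<Rightarrow> 'a"
  where "ergodic_avg bet x k = (\<Sum>i=1..k. bet i *\<^sub>R x (i + 1)) /\<^sub>R (\<Sum>i=1..k. bet i)"

end

theory Submission
  imports Defs
begin

text \<open>Write \<open>\<beta>\<^sub>k\<close> for \<open>bet k\<close>, \<open>r\<^sub>k = B y\<^sub>k + C z\<^sub>k - b\<close>, \<open>d\<^sub>k = z\<^sub>k\<^sub>+\<^sub>1 - z\<^sub>k\<close>,
  \<open>M = C\<^sup>T C + Q\<close>, and \<open>gap (y, z) = f(y) + g(z) - f(y\<^sup>*) - g(z\<^sup>*)\<close>.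
  The proof bounds, for every multiplier \<open>l\<close>, the weighted Lagrangian gaps
  \<open>\<beta>\<^sub>k (gap x\<^sub>k\<^sub>+\<^sub>1 + l \<bullet> r\<^sub>k\<^sub>+\<^sub>1)\<close> by a telescoping difference of a nonnegative potential
  (lemma \<open>potential_descent\<close>). The factor \<open>\<beta>\<^sub>k\<close> is what makes the weights of the average appear,
  and it fits the growth of the penalty: after this multiplication the \<open>z\<close>-distances carry the weight \<open>\<beta>\<^sub>k\<^sup>2\<close>,
  and the step rule lets \<open>\<beta>\<^sub>k\<^sub>+\<^sub>1\<^sup>2 - \<beta>\<^sub>k\<^sup>2\<close> be at most what the term
  \<open>\<beta>\<^sub>k \<sigma>\<^sub>g \<parallel>z\<^sub>k\<^sub>+\<^sub>1 - z\<^sup>*\<parallel>\<^sup>2 / 2\<close> of strong convexity pays for, because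
  \<open>\<parallel>w\<parallel>\<^sub>M\<^sup>2 \<le> \<lambda>\<^sub>m\<^sub>a\<^sub>x(M) \<parallel>w\<parallel>\<^sup>2\<close> (lemma \<open>bet_squared_growth\<close>).

  Each step also produces the cross term \<open>\<beta>\<^sub>k\<^sup>2 C d\<^sub>k \<bullet> r\<^sub>k\<^sub>+\<^sub>1\<close>, of unknown sign, because the \<open>y\<close>-step
  uses the old \<open>z\<^sub>k\<close>. The multiplier update leaves \<open>- (1 - \<gamma>/2) \<beta>\<^sub>k\<^sup>2 \<parallel>r\<^sub>k\<^sub>+\<^sub>1\<parallel>\<^sup>2\<close> to pay for it.
  Monotonicity of \<open>\<partial>g\<close> between two
  consecutive \<open>z\<close>-steps turns the cross term into \<open>- (\<gamma> - 1) \<beta>\<^sub>k\<^sub>-\<^sub>1 \<beta>\<^sub>k r\<^sub>k \<bullet> C d\<^sub>k\<close> plus telescoping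
  \<open>Q\<close>-terms (lemma \<open>cross_term_bound\<close>). Young's inequality then absorbs it provided that
  \<open>(\<gamma> - 1)\<^sup>2 \<le> 2 - \<gamma>\<close>, which is exactly the golden ratio bound on \<open>\<gamma>\<close>.

  Summation gives a bound that is uniform over bounded \<open>l\<close>. Jensen's inequality for \<open>f\<close>, \<open>g\<close> and
  linearity of the residual transfer it to the average \<open>v\<^sub>k\<close>:
  \<open>\<gamma>\<^sub>k (gap v\<^sub>k + \<rho> \<parallel>A v\<^sub>k - b\<parallel>) \<le> K\<close> after choosing \<open>l\<close> of length \<open>\<rho>\<close> along the residual. The KKT
  multiplier \<open>\<lambda>\<^sup>*\<close> gives the opposite estimate \<open>gap v\<^sub>k \<ge> - \<parallel>\<lambda>\<^sup>*\<parallel> \<parallel>A v\<^sub>k - b\<parallel>\<close>, so that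
  \<open>\<rho> = \<parallel>\<lambda>\<^sup>*\<parallel> + 1\<close> controls both quantities (lemma \<open>ergodic_rate\<close>).\<close>

section \<open>Symmetric matrices and their quadratic forms\<close>

definition quad_form :: "real^'n^'n \<Rightarrow> real^'n \<Rightarrow> real"
  where "quad_form D w = w \<bullet> (D *v w)"

lemma symmetric_dot_swap:
  fixes D :: "real^'n^'n"
  assumes "transpose D = D"
  shows "u \<bullet> (D *v w) = w \<bullet> (D *v u)"
  by (metis assms dot_lmul_matrix inner_commute transpose_matrix_vector)

lemma psd_symmetric: "psd D \<Longrightarrow> transpose D = D"
  by (simp add: psd_def)

lemma quad_form_nonneg: "psd D \<Longrightarrow> 0 \<le> quad_form D w"
  by (simp add: psd_def quad_form_def)

lemma wnorm_squared: "psd D \<Longrightarrow> (wnorm D w)\<^sup>2 = quad_form D w"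
  by (simp add: psd_def quad_form_def wnorm_def)

lemma quad_form_scaleR_matrix: "quad_form (c *\<^sub>R D) w = c * quad_form D w"
  by (simp add: quad_form_def scaleR_matrix_vector_assoc[symmetric])

lemma quad_form_add_matrix: "quad_form (D + E) w = quad_form D w + quad_form E w"
  by (simp add: quad_form_def matrix_vector_mult_add_rdistrib inner_right_distrib)

lemma quad_form_gram: "quad_form (transpose C ** C) w = (norm (C *v w))\<^sup>2"
proof -
  have "quad_form (transpose C ** C) w = ((C *v w) v* C) \<bullet> w"
    unfolding quad_form_def matrix_vector_mul_assoc[symmetric] transpose_matrix_vector
    by (rule inner_commute)
  then show ?thesis by (simp only: dot_lmul_matrix power2_norm_eq_inner)
qed

lemma loewner_le_quad_form:
  assumes "loewner_le D E"
  shows "quad_form D w \<le> quad_form E w"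
  using assms unfolding loewner_le_def psd_def quad_form_def
  by (simp add: matrix_vector_mult_diff_rdistrib inner_diff_right)

lemma psd_scaleR: "psd D \<Longrightarrow> 0 \<le> c \<Longrightarrow> psd (c *\<^sub>R D)"
  by (simp add: psd_def scaleR_matrix_vector_assoc[symmetric] transpose_scalar)

lemma psd_gram: "psd (transpose C ** C)"
  using quad_form_gram[of C]
  by (simp add: psd_def quad_form_def matrix_transpose_mul transpose_transpose)

lemma psd_add: "psd D \<Longrightarrow> psd E \<Longrightarrow> psd (D + E)"
  by (auto simp add: psd_def matrix_vector_mult_add_rdistrib inner_right_distrib
      transpose_def vec_eq_iff)

lemma quad_form_add:
  assumes "transpose D = D"
  shows "quad_form D (u + w) = quad_form D u + 2 * (u \<bullet> (D *v w)) + quad_form D w"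
  using symmetric_dot_swap[OF assms, of u w]
  by (simp add: quad_form_def matrix_vector_right_distrib inner_add_left inner_add_right)

lemma quad_form_diff:
  assumes "transpose D = D"
  shows "quad_form D (u - w) = quad_form D u - 2 * (u \<bullet> (D *v w)) + quad_form D w"
  using symmetric_dot_swap[OF assms, of u w]
  by (simp add: quad_form_def matrix_vector_mult_diff_distrib inner_diff_left inner_diff_right)

lemma quad_form_scaleR: "quad_form D (t *\<^sub>R w) = t\<^sup>2 * quad_form D w"
  by (simp add: quad_form_def matrix_vector_mult_scaleR power2_eq_square)

lemma three_point_identity:
  assumes "transpose D = D"
  shows "2 * ((D *v (u - v)) \<bullet> (u - s)) =
         quad_form D (u - s) - quad_form D (v - s) + quad_form D (u - v)"
proof -
  have "v - s = (u - s) - (u - v)" by simp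
  then show ?thesis
    using quad_form_diff[OF assms, of "u - s" "u - v"] by (simp add: inner_commute)
qed

lemma psd_young:
  assumes "psd D"
  shows "2 * (u \<bullet> (D *v w)) \<le> quad_form D u + quad_form D w"
  using quad_form_nonneg[OF assms, of "u - w"] quad_form_diff[OF psd_symmetric[OF assms], of u w]
  by simp

lemma symmetric_eigenvectors_orthogonal:
  fixes D :: "real^'n^'n"
  assumes D: "transpose D = D" and u: "D *v u = a *\<^sub>R u" and w: "D *v w = c *\<^sub>R w" and "a \<noteq> c"
  shows "u \<bullet> w = 0"
  using symmetric_dot_swap[OF D, of u w] assms by (simp add: inner_commute)

text \<open>One eigenvector per eigenvalue gives an orthogonal, hence independent, family. Finiteness makes the
  maximum in \<^const>\<open>lambda_max\<close> meaningful.\<close>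
lemma finite_eigenvalues_symmetric:
  fixes D :: "real^'n^'n"
  assumes D: "transpose D = D"
  shows "finite {e. \<exists>v. v \<noteq> 0 \<and> D *v v = e *\<^sub>R v}" (is "finite ?E")
proof -
  define v where "v e = (SOME v. v \<noteq> 0 \<and> D *v v = e *\<^sub>R v)" for e
  have v: "v e \<noteq> 0 \<and> D *v v e = e *\<^sub>R v e" if "e \<in> ?E" for e
    using that someI_ex[of "\<lambda>v. v \<noteq> 0 \<and> D *v v = e *\<^sub>R v"] by (simp add: v_def)
  have orth: "v e \<bullet> v e' = 0" if "e \<in> ?E" "e' \<in> ?E" "e \<noteq> e'" for e e'
    using symmetric_eigenvectors_orthogonal[OF D] v that by blast
  have inj: "inj_on v ?E"
  proof (rule inj_onI, rule ccontr)
    fix e e' assume "e \<in> ?E" "e' \<in> ?E" "v e = v e'" "e \<noteq> e'"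
    then show False using orth[of e e'] v[of e'] by simp
  qed
  have "pairwise orthogonal (v ` ?E)"
    unfolding pairwise_image orthogonal_def by (rule pairwiseI) (use orth in blast)
  moreover have "0 \<notin> v ` ?E" using v by force
  ultimately have "independent (v ` ?E)" by (rule pairwise_orthogonal_independent)
  then have "finite (v ` ?E)" using independent_bound by blast
  then show ?thesis using inj finite_imageD by blast
qed

text \<open>A nonnegative quadratic form is minimal at \<open>v\<close>, so its gradient \<open>2 D v\<close> vanishes there; the proof
  moves from \<open>v\<close> against \<open>D v\<close> by a small step.\<close>
lemma psd_kernel:
  assumes D: "psd D" and v: "quad_form D v = 0"
  shows "D *v v = 0"
proof -
  define w where "w = D *v v"
  have ineq: "0 \<le> quad_form D w * t\<^sup>2 - 2 * t * (norm w)\<^sup>2" for t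
    using quad_form_nonneg[OF D, of "v - t *\<^sub>R w"] v
      quad_form_diff[OF psd_symmetric[OF D], of v "t *\<^sub>R w"]
      symmetric_dot_swap[OF psd_symmetric[OF D], of v w]
    by (simp add: quad_form_scaleR matrix_vector_mult_scaleR power2_norm_eq_inner w_def mult.commute)
  show ?thesis
  proof (rule ccontr)
    assume "D *v v \<noteq> 0"
    then have n: "(norm w)\<^sup>2 > 0" by (simp add: w_def)
    have q: "quad_form D w \<ge> 0" using D by (rule quad_form_nonneg)
    (* Any sufficiently small positive t contradicts ineq; adding 1 keeps the denominator positive. *)
    define t where "t = (norm w)\<^sup>2 / (quad_form D w + 1)"
    have t: "t > 0" using n q by (simp add: t_def)
    have "2 * (norm w)\<^sup>2 \<le> quad_form D w * t"
    proof -
      have "t * (2 * (norm w)\<^sup>2) \<le> t * (quad_form D w * t)"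
        using ineq[of t] by (simp add: power2_eq_square algebra_simps)
      then show ?thesis using t by simp
    qed
    also have "\<dots> \<le> (norm w)\<^sup>2"
      using q n by (simp add: t_def field_simps)
    finally show False using n by simp
  qed
qed

text \<open>The maximum \<open>m\<close> of the Rayleigh quotient is attained on the unit sphere. There \<open>m I - D\<close> is positive
  semidefinite with a zero of its quadratic form, so the maximizer is an eigenvector for \<open>m\<close>.\<close>
lemma quad_form_le_lambda_max:
  fixes D :: "real^'n^'n"
  assumes D: "transpose D = D"
  shows "quad_form D w \<le> lambda_max D * (norm w)\<^sup>2"
proof -
  have ne: "sphere (0::real^'n) 1 \<noteq> {}" by simp
  have "continuous_on (sphere 0 1) (quad_form D)"
    unfolding quad_form_def
    by (intro continuous_intros linear_continuous_on_compose matrix_vector_mul_linear)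
  then obtain v where v: "v \<in> sphere 0 1"
    and max: "\<And>u. u \<in> sphere 0 1 \<Longrightarrow> quad_form D u \<le> quad_form D v"
    using continuous_attains_sup[OF compact_sphere ne] by blast
  define m where "m = quad_form D v"
  have le: "quad_form D u \<le> m * (norm u)\<^sup>2" for u
  proof (cases "u = 0")
    case False
    have "quad_form D ((1 / norm u) *\<^sub>R u) \<le> m"
      unfolding m_def using False by (intro max) simp
    then show ?thesis using False by (simp add: quad_form_scaleR field_simps power2_eq_square)
  qed (simp add: quad_form_def)
  have E: "(m *\<^sub>R mat 1 - D) *v u = m *\<^sub>R u - D *v u" for u
    by (simp add: matrix_vector_mult_diff_rdistrib scaleR_matrix_vector_assoc[symmetric])
  have qE: "quad_form (m *\<^sub>R mat 1 - D) u = m * (norm u)\<^sup>2 - quad_form D u" for u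
    by (simp add: quad_form_def E inner_diff_right power2_norm_eq_inner)
  have "transpose (m *\<^sub>R mat 1 - D) = m *\<^sub>R mat 1 - D"
    using D by (simp add: transpose_def vec_eq_iff mat_def)
  then have "psd (m *\<^sub>R mat 1 - D)"
    using le qE by (simp add: psd_def quad_form_def[symmetric])
  moreover have "quad_form (m *\<^sub>R mat 1 - D) v = 0"
    unfolding qE using v by (simp add: m_def)
  ultimately have "D *v v = m *\<^sub>R v"
    using psd_kernel E by (metis right_minus_eq)
  moreover have "v \<noteq> 0" using v by auto
  ultimately have "m \<le> lambda_max D"
    unfolding lambda_max_def by (intro Max_ge finite_eigenvalues_symmetric[OF D]) auto
  then show ?thesis using le[of w] by (meson mult_right_mono order_trans zero_le_power2)
qed

section \<open>Extended-valued convex functions\<close>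

lemma real_part:
  "proper_fun f \<Longrightarrow> f u \<noteq> \<infinity> \<Longrightarrow> f u = ereal (real_of_ereal (f u))"
  by (cases "f u") (auto simp: proper_fun_def)

text \<open>Passing to real values on the effective domain makes the theory of real convex functions, in
  particular Jensen's inequality, applicable.\<close>
lemma convex_on_finite_part:
  assumes p: "proper_fun f" and c: "convex_fun f"
  shows "convex_on {u. f u \<noteq> \<infinity>} (\<lambda>u. real_of_ereal (f u))"
proof -
  have *: "f (s *\<^sub>R u + t *\<^sub>R w) \<le> ereal (s * real_of_ereal (f u) + t * real_of_ereal (f w))"
    if "f u \<noteq> \<infinity>" "f w \<noteq> \<infinity>" "s \<ge> 0" "t \<ge> 0" "s + t = 1" for u w s t
    using c that real_part[OF p] unfolding convex_fun_def
    by (metis plus_ereal.simps(1) times_ereal.simps(1))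
  have dom: "convex {u. f u \<noteq> \<infinity>}"
    unfolding convex_def using * by fastforce
  show ?thesis
  proof (unfold convex_on_def, intro conjI ballI allI impI)
    fix u w s t
    assume "u \<in> {u. f u \<noteq> \<infinity>}" "w \<in> {u. f u \<noteq> \<infinity>}"
      and st: "s \<ge> (0::real)" "t \<ge> 0" "s + t = 1"
    then have uw: "f u \<noteq> \<infinity>" "f w \<noteq> \<infinity>" by auto
    have le: "f (s *\<^sub>R u + t *\<^sub>R w) \<le> ereal (s * real_of_ereal (f u) + t * real_of_ereal (f w))"
      using * uw st by blast
    then have "f (s *\<^sub>R u + t *\<^sub>R w) \<noteq> \<infinity>" by auto
    then show "real_of_ereal (f (s *\<^sub>R u + t *\<^sub>R w))
        \<le> s * real_of_ereal (f u) + t * real_of_ereal (f w)"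
      using le real_part[OF p] by (metis ereal_less_eq(3))
  qed (rule dom)
qed

lemma subgradient_finite:
  assumes "proper_fun f" "\<xi> \<in> subdifferential f u"
  shows "f u \<noteq> \<infinity>"
  using assms unfolding proper_fun_def subdifferential_def by fastforce

lemma subgradient_ineq:
  assumes p: "proper_fun f" and s: "\<xi> \<in> subdifferential f u" and "f w \<noteq> \<infinity>"
  shows "real_of_ereal (f u) + \<xi> \<bullet> (w - u) \<le> real_of_ereal (f w)"
proof -
  have "f u + ereal (\<xi> \<bullet> (w - u)) \<le> f w" using s by (simp add: subdifferential_def)
  then show ?thesis
    using real_part[OF p subgradient_finite[OF p s]] real_part[OF p, of w] assms(3)
    by (metis ereal_less_eq(3) plus_ereal.simps(1))
qed

text \<open>First-order information is extracted from inequalities along a segment by letting \<open>t\<close> tend to 0.\<close>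
lemma nonneg_intercept:
  fixes a q :: real
  assumes "\<And>t. 0 < t \<Longrightarrow> t < 1 \<Longrightarrow> 0 \<le> a + t * q"
  shows "0 \<le> a"
proof -
  have "((\<lambda>t. a + t * q) \<longlongrightarrow> a + 0 * q) (at_right 0)" by (intro tendsto_intros)
  moreover have "\<forall>\<^sub>F t in at_right 0. 0 \<le> a + t * q"
    using assms by (auto simp: eventually_at_right_field intro!: exI[of _ 1])
  ultimately show ?thesis by (simp add: tendsto_lowerbound)
qed

text \<open>Fermat's rule for \<open>f + h\<close> with \<open>G\<close> the gradient of \<open>h\<close> at the minimizer: comparing \<open>u\<close> with
  \<open>u + t (w - u)\<close>, convexity bounds the change of \<open>f\<close> linearly in \<open>t\<close>, while the quadratic part of \<open>h\<close>
  disappears to first order.\<close>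
lemma minimizer_plus_quadratic:
  fixes f :: "'a::real_inner \<Rightarrow> ereal" and h :: "'a \<Rightarrow> real"
  assumes p: "proper_fun f" and c: "convex_fun f"
    and min: "is_arg_min (\<lambda>u. f u + ereal (h u)) (\<lambda>_. True) u"
    and quad: "\<And>t d. h (u + t *\<^sub>R d) = h u + t * (G \<bullet> d) + t\<^sup>2 * q d"
  shows "- G \<in> subdifferential f u"
proof -
  have le: "f u + ereal (h u) \<le> f w + ereal (h w)" for w
    using min by (simp add: is_arg_min_linorder)
  have fin: "f u \<noteq> \<infinity>"
  proof -
    obtain w where "f w \<noteq> \<infinity>" using p by (auto simp: proper_fun_def)
    then show ?thesis using le[of w] real_part[OF p, of w] by auto
  qed
  have "f u + ereal ((- G) \<bullet> (w - u)) \<le> f w" for w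
  proof (cases "f w = \<infinity>")
    case False
    define \<phi> where "\<phi> = (\<lambda>u. real_of_ereal (f u))"
    have "0 \<le> \<phi> w - \<phi> u + G \<bullet> (w - u)"
    proof (rule nonneg_intercept)
      fix t :: real assume t: "0 < t" "t < 1"
      define m where "m = u + t *\<^sub>R (w - u)"
      have m: "m = (1 - t) *\<^sub>R u + t *\<^sub>R w" by (simp add: m_def algebra_simps)
      have cv: "convex_on {u. f u \<noteq> \<infinity>} \<phi>"
        unfolding \<phi>_def using convex_on_finite_part[OF p c] .
      then have mfin: "f m \<noteq> \<infinity>"
        using fin False t convexD[OF convex_on_imp_convex[OF cv], of u w "1 - t" t]
        by (simp add: m)
      have "\<phi> m \<le> (1 - t) * \<phi> u + t * \<phi> w"
        unfolding m using convex_onD[OF cv, of t u w] fin False t by simp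
      moreover have "\<phi> u + h u \<le> \<phi> m + h m"
        using le[of m] real_part[OF p fin] real_part[OF p mfin]
        unfolding \<phi>_def by (metis ereal_less_eq(3) plus_ereal.simps(1))
      moreover have "h m = h u + t * (G \<bullet> (w - u)) + t\<^sup>2 * q (w - u)"
        unfolding m_def by (rule quad)
      ultimately have "0 \<le> t * (\<phi> w - \<phi> u + G \<bullet> (w - u) + t * q (w - u))"
        by (simp add: algebra_simps power2_eq_square)
      then show "0 \<le> \<phi> w - \<phi> u + G \<bullet> (w - u) + t * q (w - u)"
        using t by (simp add: zero_le_mult_iff)
    qed
    then have "ereal (\<phi> u) + ereal ((- G) \<bullet> (w - u)) \<le> ereal (\<phi> w)" by simp
    then show ?thesis
      using real_part[OF p fin] real_part[OF p False] by (simp add: \<phi>_def)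
  qed simp
  then show ?thesis by (simp add: subdifferential_def)
qed

lemma norm_add_scaleR_squared:
  fixes u d :: "'a::real_inner"
  shows "(norm (u + t *\<^sub>R d))\<^sup>2 = (norm u)\<^sup>2 + 2 * t * (u \<bullet> d) + t\<^sup>2 * (norm d)\<^sup>2"
  unfolding power2_norm_eq_inner
  by (simp add: inner_add_left inner_add_right inner_commute power2_eq_square algebra_simps)

text \<open>The gradient of the smooth part of the subproblem at the minimizer is the argument of the minus sign.\<close>
lemma proximal_step_subgradient:
  fixes f :: "real^'n1 \<Rightarrow> ereal" and B :: "real^'n1^'m" and C :: "real^'n2^'m"
  assumes p: "proper_fun f" and c: "convex_fun f" and D: "psd D"
    and min: "is_arg_min (y_obj f B C b bk D yk zk lk) (\<lambda>_. True) u"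
  shows "- (transpose B *v (lk + bk *\<^sub>R (B *v u + C *v zk - b)) + D *v (u - yk))
           \<in> subdifferential f u"
proof (rule minimizer_plus_quadratic[OF p c])
  let ?h = "\<lambda>y. lk \<bullet> (B *v y) + bk / 2 * (norm (B *v y + C *v zk - b))\<^sup>2
                 + 1 / 2 * (wnorm D (y - yk))\<^sup>2"
  show "is_arg_min (\<lambda>y. f y + ereal (?h y)) (\<lambda>_. True) u"
    using min by (simp add: y_obj_def[abs_def])
  fix t d
  let ?G = "transpose B *v (lk + bk *\<^sub>R (B *v u + C *v zk - b)) + D *v (u - yk)"
  have 1: "(norm (B *v (u + t *\<^sub>R d) + C *v zk - b))\<^sup>2 =
        (norm (B *v u + C *v zk - b))\<^sup>2 + 2 * t * ((B *v u + C *v zk - b) \<bullet> (B *v d))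
          + t\<^sup>2 * (norm (B *v d))\<^sup>2"
  proof -
    have "B *v (u + t *\<^sub>R d) + C *v zk - b = (B *v u + C *v zk - b) + t *\<^sub>R (B *v d)"
      by (simp add: algebra_simps)
    then show ?thesis by (simp only: norm_add_scaleR_squared)
  qed
  have 2: "quad_form D (u + t *\<^sub>R d - yk) =
      quad_form D (u - yk) + 2 * t * ((D *v (u - yk)) \<bullet> d) + t\<^sup>2 * quad_form D d"
  proof -
    have "u + t *\<^sub>R d - yk = (u - yk) + t *\<^sub>R d" by simp
    then show ?thesis
      using symmetric_dot_swap[OF psd_symmetric[OF D], of "u - yk" d]
      by (simp only: quad_form_add[OF psd_symmetric[OF D]])
         (simp add: quad_form_scaleR matrix_vector_mult_scaleR inner_commute)
  qed
  have 3: "?G \<bullet> d = lk \<bullet> (B *v d) + bk * ((B *v u + C *v zk - b) \<bullet> (B *v d))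
                  + (D *v (u - yk)) \<bullet> d"
    by (simp add: dot_lmul_matrix inner_add_left)
  have 4: "lk \<bullet> (B *v (u + t *\<^sub>R d)) = lk \<bullet> (B *v u) + t * (lk \<bullet> (B *v d))"
    by (simp add: matrix_vector_right_distrib matrix_vector_mult_scaleR inner_add_right)
  have 5: "(l0 + t * l1) + bk / 2 * (n0 + 2 * t * n1 + t\<^sup>2 * n2) + 1 / 2 * (q0 + 2 * t * q1 + t\<^sup>2 * q2)
      = (l0 + bk / 2 * n0 + 1 / 2 * q0) + t * (l1 + bk * n1 + q1) + t\<^sup>2 * (bk / 2 * n2 + q2 / 2)"
    for l0 l1 n0 n1 n2 q0 q1 q2 :: real
    by (simp add: algebra_simps)
  show "?h (u + t *\<^sub>R d) = ?h u + t * (?G \<bullet> d)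
      + t\<^sup>2 * (bk / 2 * (norm (B *v d))\<^sup>2 + quad_form D d / 2)"
    unfolding 1 3 4 wnorm_squared[OF D] 2 by (rule 5)
qed

text \<open>The two subproblems have the same shape, so one optimality lemma serves both blocks.\<close>
lemma z_obj_eq_y_obj: "z_obj g B C b bk D ynew zk lk = y_obj g C B b bk D zk ynew lk"
  by (simp add: fun_eq_iff z_obj_def y_obj_def add.commute)

section \<open>Weighted averages\<close>

lemma ergodic_avg_weighted:
  "ergodic_avg w u k = (\<Sum>i=1..k. (w i / penalty_sum w k) *\<^sub>R u (i + 1))"
  by (simp add: ergodic_avg_def penalty_sum_def scaleR_sum_right divide_inverse mult.commute)

lemma penalty_sum_scaleR_ergodic_avg:
  "penalty_sum w k \<noteq> 0 \<Longrightarrow>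
    penalty_sum w k *\<^sub>R ergodic_avg w u k = (\<Sum>i=1..k. w i *\<^sub>R u (i + 1))"
  by (simp add: ergodic_avg_def penalty_sum_def)

lemma ergodic_avg_finite_jensen:
  assumes p: "proper_fun f" and c: "convex_fun f" and k: "k \<ge> 1"
    and w: "\<And>i. i \<ge> 1 \<Longrightarrow> 0 < w i"
    and fin: "\<And>i. i \<ge> 1 \<Longrightarrow> f (u (i + 1)) \<noteq> \<infinity>"
  shows "f (ergodic_avg w u k) \<noteq> \<infinity>"
    and "penalty_sum w k * real_of_ereal (f (ergodic_avg w u k))
          \<le> (\<Sum>i=1..k. w i * real_of_ereal (f (u (i + 1))))"
proof -
  have pos: "penalty_sum w k > 0"
    unfolding penalty_sum_def using k w by (intro sum_pos) auto
  have sum1: "(\<Sum>i=1..k. w i / penalty_sum w k) = 1"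
    using pos by (simp add: sum_divide_distrib[symmetric] penalty_sum_def)
  have nonneg: "w i / penalty_sum w k \<ge> 0" if "i \<in> {1..k}" for i
    using that w[of i] pos by simp
  have dom: "u (i + 1) \<in> {v. f v \<noteq> \<infinity>}" if "i \<in> {1..k}" for i
    using that fin[of i] by simp
  note cv = convex_on_finite_part[OF p c]
  have "(\<Sum>i=1..k. (w i / penalty_sum w k) *\<^sub>R u (i + 1)) \<in> {v. f v \<noteq> \<infinity>}"
    by (rule convex_sum[OF _ convex_on_imp_convex[OF cv] sum1]) (use nonneg dom in auto)
  then show "f (ergodic_avg w u k) \<noteq> \<infinity>" by (simp add: ergodic_avg_weighted)
  have "real_of_ereal (f (\<Sum>i=1..k. (w i / penalty_sum w k) *\<^sub>R u (i + 1)))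
      \<le> (\<Sum>i=1..k. w i / penalty_sum w k * real_of_ereal (f (u (i + 1))))"
    by (rule convex_on_sum[OF _ _ cv sum1]) (use nonneg dom k in auto)
  also have "\<dots> = (\<Sum>i=1..k. w i * real_of_ereal (f (u (i + 1)))) / penalty_sum w k"
    by (simp add: sum_divide_distrib)
  finally show "penalty_sum w k * real_of_ereal (f (ergodic_avg w u k))
          \<le> (\<Sum>i=1..k. w i * real_of_ereal (f (u (i + 1))))"
    using pos by (simp add: ergodic_avg_weighted field_simps)
qed

lemma fst_ergodic_avg: "fst (ergodic_avg w u k) = ergodic_avg w (\<lambda>i. fst (u i)) k"
  by (simp add: ergodic_avg_def fst_sum)

lemma snd_ergodic_avg: "snd (ergodic_avg w u k) = ergodic_avg w (\<lambda>i. snd (u i)) k"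
  by (simp add: ergodic_avg_def snd_sum)

section \<open>Setting of the algorithm and optimality conditions\<close>

locale iadmm =
  fixes f :: "real^'n1 \<Rightarrow> ereal" and g :: "real^'n2 \<Rightarrow> ereal"
    and B :: "real^'n1^'m" and C :: "real^'n2^'m" and b :: "real^'m"
    and \<sigma>\<^sub>g \<gamma> \<epsilon> \<beta> :: real
    and Q :: "real^'n2^'n2" and P :: "nat \<Rightarrow> real^'n1^'n1"
    and bet :: "nat \<Rightarrow> real"
    and x :: "nat \<Rightarrow> (real^'n1) \<times> (real^'n2)" and lam :: "nat \<Rightarrow> real^'m"
    and xs :: "(real^'n1) \<times> (real^'n2)" and ls :: "real^'m"
  assumes f_proper: "proper_fun f" and f_convex: "convex_fun f"
    and g_proper: "proper_fun g" and g_convex: "convex_fun g"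
    and sigma_nonneg: "\<sigma>\<^sub>g \<ge> 0"
    and sigma: "\<And>u w \<xi>. \<xi> \<in> subdifferential g w \<Longrightarrow>
                  g u - g w \<ge> ereal (\<xi> \<bullet> (u - w) + \<sigma>\<^sub>g / 2 * (norm (u - w))\<^sup>2)"
    and kkt: "kkt_solution f g B C b (fst xs) (snd xs) ls"
    and gamma: "1 < \<gamma>" "\<gamma> < (1 + sqrt 5) / 2"
    and eps: "0 < \<epsilon>" "\<epsilon> < 1"
    and beta: "0 < \<beta>"
    and Q: "psd Q"
    and P: "\<And>k. k \<ge> 1 \<Longrightarrow> psd (P k)"
    and P_mono: "\<And>k. k \<ge> 1 \<Longrightarrow> loewner_le (bet (k + 1) *\<^sub>R P (k + 1)) (bet k *\<^sub>R P k)"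
    and lmax_pos: "lambda_max (transpose C ** C + Q) > 0"
    and bet_init: "bet 1 \<ge> \<beta>"
    and y_step: "\<And>k. k \<ge> 1 \<Longrightarrow>
          is_arg_min (y_obj f B C b (bet k) (P k) (fst (x k)) (snd (x k)) (lam k))
            (\<lambda>_. True) (fst (x (k + 1)))"
    and z_step: "\<And>k. k \<ge> 1 \<Longrightarrow>
          is_arg_min (z_obj g B C b (bet k) (bet k *\<^sub>R Q) (fst (x (k + 1))) (snd (x k)) (lam k))
            (\<lambda>_. True) (snd (x (k + 1)))"
    and lam_step: "\<And>k. k \<ge> 1 \<Longrightarrow>
          lam (k + 1) = lam k + (\<gamma> * bet k) *\<^sub>R (B *v fst (x (k + 1)) + C *v snd (x (k + 1)) - b)"
    and bet_step: "\<And>k. k \<ge> 1 \<Longrightarrow> \<beta> \<le> bet (k + 1) \<and>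
          bet (k + 1) \<le> sqrt ((bet k)\<^sup>2 + (1 - \<epsilon>) * \<sigma>\<^sub>g * bet k / lambda_max (transpose C ** C + Q))"
begin

abbreviation "y k \<equiv> fst (x k)"
abbreviation "z k \<equiv> snd (x k)"
abbreviation "ys \<equiv> fst xs"
abbreviation "zs \<equiv> snd xs"
abbreviation "\<phi> u \<equiv> real_of_ereal (f u)"
abbreviation "\<psi> w \<equiv> real_of_ereal (g w)"

definition "M = transpose C ** C + Q"
definition "res k = B *v y k + C *v z k - b"
definition "dz k = z (k + 1) - z k"
definition "gap u w = (\<phi> u + \<psi> w) - (\<phi> ys + \<psi> zs)"

text \<open>The roots of \<open>(t - 1)\<^sup>2 = 2 - t\<close> are \<open>(1 \<plusminus> sqrt 5) / 2\<close>.\<close>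
lemma gamma_golden: "(\<gamma> - 1)\<^sup>2 \<le> 2 - \<gamma>"
proof -
  have "(2 * \<gamma> - 1)\<^sup>2 \<le> (sqrt 5)\<^sup>2"
    using gamma by (intro power_mono) auto
  then show ?thesis by (simp add: power2_eq_square algebra_simps)
qed

lemma gamma_less_2: "\<gamma> < 2"
proof -
  have "sqrt 5 < sqrt 9" by (intro real_sqrt_less_mono) simp
  then show ?thesis using gamma by simp
qed

lemma bet_pos: "k \<ge> 1 \<Longrightarrow> 0 < bet k"
proof (induction k rule: dec_induct)
  case base then show ?case using bet_init beta by simp
next
  case (step n) then show ?case using bet_step[of n] beta by simp
qed

lemma M_psd: "psd M"
  unfolding M_def by (intro psd_add psd_gram Q)

text \<open>The increase of \<open>\<beta>\<^sub>k\<^sup>2\<close> permitted by the step rule, measured in the \<open>M\<close>-norm, is paid for by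
  strong convexity of \<open>g\<close>.\<close>
lemma bet_squared_growth:
  assumes k: "k \<ge> 1"
  shows "(bet (k + 1))\<^sup>2 * quad_form M w \<le> (bet k)\<^sup>2 * quad_form M w + bet k * \<sigma>\<^sub>g * (norm w)\<^sup>2"
proof -
  define L where "L = lambda_max M"
  have L: "L > 0" using lmax_pos by (simp add: L_def M_def)
  have bk: "bet k > 0" using bet_pos k .
  have bk1: "bet (k + 1) > 0" using bet_pos[of "k + 1"] by simp
  have "0 \<le> (1 - \<epsilon>) * \<sigma>\<^sub>g * bet k / L" using eps sigma_nonneg bk L by simp
  moreover have "bet (k + 1) \<le> sqrt ((bet k)\<^sup>2 + (1 - \<epsilon>) * \<sigma>\<^sub>g * bet k / L)"
    using bet_step[OF k] by (simp add: L_def M_def)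
  then have "(bet (k + 1))\<^sup>2 \<le> (sqrt ((bet k)\<^sup>2 + (1 - \<epsilon>) * \<sigma>\<^sub>g * bet k / L))\<^sup>2"
    using bk1 by (intro power_mono) auto
  ultimately have "(bet (k + 1))\<^sup>2 \<le> (bet k)\<^sup>2 + (1 - \<epsilon>) * \<sigma>\<^sub>g * bet k / L" by simp
  also have "\<dots> \<le> (bet k)\<^sup>2 + \<sigma>\<^sub>g * bet k / L"
  proof -
    have "(1 - \<epsilon>) * (\<sigma>\<^sub>g * bet k) \<le> 1 * (\<sigma>\<^sub>g * bet k)"
      using eps sigma_nonneg bk by (intro mult_right_mono) auto
    then show ?thesis using L by (simp add: divide_right_mono mult.assoc)
  qed
  finally have "(bet (k + 1))\<^sup>2 * quad_form M w \<le> ((bet k)\<^sup>2 + \<sigma>\<^sub>g * bet k / L) * quad_form M w"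
    by (intro mult_right_mono quad_form_nonneg M_psd)
  also have "\<dots> \<le> (bet k)\<^sup>2 * quad_form M w + \<sigma>\<^sub>g * bet k / L * (L * (norm w)\<^sup>2)"
  proof -
    have "\<sigma>\<^sub>g * bet k / L * quad_form M w \<le> \<sigma>\<^sub>g * bet k / L * (L * (norm w)\<^sup>2)"
      using quad_form_le_lambda_max[OF psd_symmetric[OF M_psd], of w] sigma_nonneg bk L
      by (intro mult_left_mono) (auto simp: L_def)
    then show ?thesis by (simp add: distrib_right)
  qed
  also have "\<sigma>\<^sub>g * bet k / L * (L * (norm w)\<^sup>2) = bet k * \<sigma>\<^sub>g * (norm w)\<^sup>2"
    using L by simp
  finally show ?thesis .
qed

text \<open>The subproblem sees the old \<open>z\<^sub>k\<close>, so the residual in its optimality condition is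
  \<open>r\<^sub>k\<^sub>+\<^sub>1 - C d\<^sub>k\<close>; the deviation \<open>C d\<^sub>k\<close> is the source of the cross term.\<close>
lemma y_optimality:
  assumes k: "k \<ge> 1"
  shows "- (transpose B *v (lam k + bet k *\<^sub>R (res (k + 1) - C *v dz k)) + P k *v (y (k + 1) - y k))
          \<in> subdifferential f (y (k + 1))"
proof -
  have "B *v y (k + 1) + C *v z k - b = res (k + 1) - C *v dz k"
    by (simp add: res_def dz_def matrix_vector_mult_diff_distrib)
  then show ?thesis
    using proximal_step_subgradient[OF f_proper f_convex P[OF k] y_step[OF k]] by metis
qed

lemma z_optimality:
  assumes k: "k \<ge> 1"
  shows "- (transpose C *v (lam k + bet k *\<^sub>R res (k + 1)) + bet k *\<^sub>R (Q *v dz k))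
          \<in> subdifferential g (z (k + 1))"
proof -
  have "C *v z (k + 1) + B *v y (k + 1) - b = res (k + 1)"
    by (simp add: res_def add.commute)
  moreover have "psd (bet k *\<^sub>R Q)"
    using psd_scaleR[OF Q] bet_pos[OF k] by simp
  ultimately show ?thesis
    using proximal_step_subgradient[OF g_proper g_convex _ z_step[OF k, unfolded z_obj_eq_y_obj]]
    by (metis dz_def scaleR_matrix_vector_assoc)
qed

lemma f_finite: "k \<ge> 1 \<Longrightarrow> f (y (k + 1)) \<noteq> \<infinity>"
  using subgradient_finite[OF f_proper y_optimality] .

lemma g_finite: "k \<ge> 1 \<Longrightarrow> g (z (k + 1)) \<noteq> \<infinity>"
  using subgradient_finite[OF g_proper z_optimality] .

lemma ls_subgradients:
  "- (transpose B *v ls) \<in> subdifferential f ys" "- (transpose C *v ls) \<in> subdifferential g zs"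
  using kkt unfolding kkt_solution_def by (auto simp: image_iff eq_neg_iff_add_eq_0[symmetric])

lemma feasible: "B *v ys + C *v zs = b"
  using kkt unfolding kkt_solution_def by simp

lemma solution_finite: "f ys \<noteq> \<infinity>" "g zs \<noteq> \<infinity>"
  using subgradient_finite[OF f_proper ls_subgradients(1)]
    subgradient_finite[OF g_proper ls_subgradients(2)] by auto

lemma strong_subgradient_ineq:
  assumes s: "\<xi> \<in> subdifferential g w" and u: "g u \<noteq> \<infinity>"
  shows "\<psi> w + \<xi> \<bullet> (u - w) + \<sigma>\<^sub>g / 2 * (norm (u - w))\<^sup>2 \<le> \<psi> u"
proof -
  have "ereal (\<xi> \<bullet> (u - w) + \<sigma>\<^sub>g / 2 * (norm (u - w))\<^sup>2) \<le> ereal (\<psi> u - \<psi> w)"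
    using sigma[OF s, of u] real_part[OF g_proper u]
      real_part[OF g_proper subgradient_finite[OF g_proper s]]
    by (metis ereal_minus(1))
  then show ?thesis by simp
qed

text \<open>A KKT point is a saddle point of the Lagrangian, so infeasible points can undercut the optimal
  value by at most the multiplier times the residual.\<close>
lemma gap_lower_bound:
  assumes "f u \<noteq> \<infinity>" "g w \<noteq> \<infinity>"
  shows "- (ls \<bullet> (B *v u + C *v w - b)) \<le> gap u w"
proof -
  have "- (ls \<bullet> (B *v u - B *v ys)) \<le> \<phi> u - \<phi> ys"
    using subgradient_ineq[OF f_proper ls_subgradients(1) assms(1)]
    by (simp add: dot_lmul_matrix matrix_vector_mult_diff_distrib)
  moreover have "- (ls \<bullet> (C *v w - C *v zs)) \<le> \<psi> w - \<psi> zs"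
    using subgradient_ineq[OF g_proper ls_subgradients(2) assms(2)]
    by (simp add: dot_lmul_matrix matrix_vector_mult_diff_distrib)
  ultimately show ?thesis
    by (simp add: gap_def feasible[symmetric] inner_diff_right inner_add_right)
qed

section \<open>The descent inequality\<close>

text \<open>The optimality conditions of both blocks, tested at the solution, are added. Feasibility of the
  solution turns \<open>B (y\<^sub>k\<^sub>+\<^sub>1 - y\<^sup>*)\<close> into \<open>r\<^sub>k\<^sub>+\<^sub>1 - C (z\<^sub>k\<^sub>+\<^sub>1 - z\<^sup>*)\<close>, which merges the term \<open>C d\<^sub>k\<close>
  of the first block with the term \<open>Q d\<^sub>k\<close> of the second into \<open>M d\<^sub>k\<close>.\<close>
lemma step_gap:
  assumes k: "k \<ge> 1"
  shows "gap (y (k + 1)) (z (k + 1)) + l \<bullet> res (k + 1) \<le>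
      (l - lam k) \<bullet> res (k + 1) - bet k * (norm (res (k + 1)))\<^sup>2
      + bet k * ((C *v dz k) \<bullet> res (k + 1))
      - bet k * ((M *v dz k) \<bullet> (z (k + 1) - zs))
      - (P k *v (y (k + 1) - y k)) \<bullet> (y (k + 1) - ys)
      - \<sigma>\<^sub>g / 2 * (norm (z (k + 1) - zs))\<^sup>2"
proof -
  define e where "e = z (k + 1) - zs"
  define h where "h = y (k + 1) - ys"
  define p where "p = P k *v (y (k + 1) - y k)"
  define r where "r = res (k + 1)"
  have Bh: "B *v h = r - C *v e"
    unfolding h_def e_def r_def res_def
    by (simp add: feasible[symmetric] matrix_vector_mult_diff_distrib)
  have "\<phi> (y (k + 1)) - \<phi> ys \<le> - ((lam k + bet k *\<^sub>R (r - C *v dz k)) \<bullet> (B *v h)) - p \<bullet> h"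
    using subgradient_ineq[OF f_proper y_optimality[OF k] solution_finite(1)]
    by (simp add: dot_lmul_matrix matrix_vector_mult_diff_distrib h_def p_def r_def
        inner_add_left inner_diff_left inner_diff_right algebra_simps)
  moreover have "\<psi> (z (k + 1)) - \<psi> zs \<le> - ((lam k + bet k *\<^sub>R r) \<bullet> (C *v e))
      - bet k * ((Q *v dz k) \<bullet> e) - \<sigma>\<^sub>g / 2 * (norm e)\<^sup>2"
    using strong_subgradient_ineq[OF z_optimality[OF k] solution_finite(2)]
    by (simp add: dot_lmul_matrix matrix_vector_mult_diff_distrib e_def r_def norm_minus_commute
        inner_add_left inner_diff_left inner_diff_right algebra_simps)
  moreover have "(M *v dz k) \<bullet> e = (C *v dz k) \<bullet> (C *v e) + (Q *v dz k) \<bullet> e"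
    by (simp add: M_def matrix_vector_mult_add_rdistrib matrix_vector_mul_assoc[symmetric]
        dot_lmul_matrix inner_add_left)
  moreover have "(lam k + bet k *\<^sub>R (r - C *v dz k)) \<bullet> (B *v h) + (lam k + bet k *\<^sub>R r) \<bullet> (C *v e)
      = lam k \<bullet> r + bet k * (norm r)\<^sup>2 - bet k * ((C *v dz k) \<bullet> r)
        + bet k * ((C *v dz k) \<bullet> (C *v e))"
    unfolding Bh power2_norm_eq_inner
    by (simp add: inner_add_left inner_diff_left inner_diff_right algebra_simps)
  ultimately show ?thesis
    unfolding gap_def e_def[symmetric] h_def[symmetric] p_def[symmetric] r_def[symmetric]
    by (simp add: inner_diff_left distrib_left)
qed

text \<open>Adding the subgradient inequalities of \<open>g\<close> at two consecutive iterates, each tested at the other,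
  bounds \<open>d\<^sub>j\<^sub>+\<^sub>1\<close> against the change of the multiplier estimates \<open>\<lambda>\<^sub>j + \<beta>\<^sub>j r\<^sub>j\<^sub>+\<^sub>1\<close>. As the update of
  \<open>\<lambda>\<^sub>j\<close> adds \<open>\<gamma> \<beta>\<^sub>j r\<^sub>j\<^sub>+\<^sub>1\<close>, only the fraction \<open>\<gamma> - 1\<close> of the old residual survives. Two consecutive
  steps are involved, so the estimate starts with the second step.\<close>
lemma cross_term_bound:
  assumes j: "j \<ge> 1"
  shows "(bet (j + 1))\<^sup>2 * ((C *v dz (j + 1)) \<bullet> res (j + 2)) \<le>
      - ((\<gamma> - 1) * bet j * bet (j + 1) * (res (j + 1) \<bullet> (C *v dz (j + 1))))
      - (bet (j + 1))\<^sup>2 / 2 * quad_form Q (dz (j + 1)) + (bet j)\<^sup>2 / 2 * quad_form Q (dz j)"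
proof -
  define a c where "a = bet j" and "c = bet (j + 1)"
  define d d' where "d = dz j" and "d' = dz (j + 1)"
  define r r' where "r = res (j + 1)" and "r' = res (j + 2)"
  define l where "l = lam j"
  have c: "c > 0" using bet_pos[of "j + 1"] by (simp add: c_def)
  have lam: "lam (j + 1) = l + (\<gamma> * a) *\<^sub>R r"
    using lam_step[OF j] by (simp add: l_def a_def r_def res_def)
  have s1: "- (transpose C *v (l + a *\<^sub>R r) + a *\<^sub>R (Q *v d)) \<in> subdifferential g (z (j + 1))"
    using z_optimality[OF j] by (simp add: a_def r_def d_def l_def)
  have s2: "- (transpose C *v (l + (\<gamma> * a) *\<^sub>R r + c *\<^sub>R r') + c *\<^sub>R (Q *v d'))
      \<in> subdifferential g (z (j + 2))"
    using z_optimality[of "j + 1"] lam by (simp add: c_def r'_def d'_def)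
  have d': "d' = z (j + 2) - z (j + 1)" by (simp add: d'_def dz_def)
  have fin: "g (z (j + 1)) \<noteq> \<infinity>" "g (z (j + 2)) \<noteq> \<infinity>"
    using g_finite[of j] g_finite[of "j + 1"] j by auto
  have bwd: "z (j + 1) - z (j + 2) = - d'" using d' by simp
  have "\<psi> (z (j + 1)) - (l + a *\<^sub>R r) \<bullet> (C *v d') - a * ((Q *v d) \<bullet> d') \<le> \<psi> (z (j + 2))"
    using subgradient_ineq[OF g_proper s1 fin(2)] d'[symmetric]
    by (simp add: dot_lmul_matrix inner_add_left inner_diff_left algebra_simps)
  moreover have "\<psi> (z (j + 2)) + (l + (\<gamma> * a) *\<^sub>R r + c *\<^sub>R r') \<bullet> (C *v d') + c * ((Q *v d') \<bullet> d')
      \<le> \<psi> (z (j + 1))"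
    using subgradient_ineq[OF g_proper s2 fin(1), unfolded bwd]
    by (simp add: dot_lmul_matrix inner_add_left inner_diff_left algebra_simps)
  ultimately have "(\<gamma> - 1) * a * (r \<bullet> (C *v d')) + c * (r' \<bullet> (C *v d'))
      + c * quad_form Q d' - a * (d \<bullet> (Q *v d')) \<le> 0"
    using symmetric_dot_swap[OF psd_symmetric[OF Q], of d d']
    by (simp add: quad_form_def inner_add_left inner_commute algebra_simps)
  then have "c * ((\<gamma> - 1) * a * (r \<bullet> (C *v d')) + c * (r' \<bullet> (C *v d'))
      + c * quad_form Q d' - a * (d \<bullet> (Q *v d'))) \<le> 0"
    using c by (simp add: mult_le_0_iff)
  moreover have "2 * (a * c * (d \<bullet> (Q *v d'))) \<le> a\<^sup>2 * quad_form Q d + c\<^sup>2 * quad_form Q d'"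
    using psd_young[OF Q, of "a *\<^sub>R d" "c *\<^sub>R d'"]
    by (simp add: quad_form_scaleR matrix_vector_mult_scaleR mult.assoc mult.left_commute)
  ultimately show ?thesis
    unfolding a_def[symmetric] c_def[symmetric] d_def[symmetric] d'_def[symmetric]
      r_def[symmetric] r'_def[symmetric]
    by (simp add: power2_eq_square inner_commute algebra_simps)
qed

text \<open>State reached after step \<open>j\<close>. The first three terms are distances of the next multiplier and
  iterate to \<open>l\<close> and the solution; the last two store what the cross term of the following step consumes.\<close>
definition "potential l j =
    (norm (l - lam (j + 1)))\<^sup>2 / (2 * \<gamma>)
    + bet (j + 1) / 2 * quad_form (P (j + 1)) (y (j + 1) - ys)
    + (bet (j + 1))\<^sup>2 / 2 * quad_form M (z (j + 1) - zs)
    + (bet j)\<^sup>2 / 2 * quad_form Q (dz j)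
    + (2 - \<gamma>) / 2 * (bet j)\<^sup>2 * (norm (res (j + 1)))\<^sup>2"

lemma potential_nonneg: "j \<ge> 1 \<Longrightarrow> 0 \<le> potential l j"
  unfolding potential_def
  using gamma gamma_less_2 bet_pos[of "j + 1"]
  by (intro add_nonneg_nonneg mult_nonneg_nonneg divide_nonneg_nonneg quad_form_nonneg P M_psd Q) auto

text \<open>After multiplication by \<open>\<beta>\<^sub>j\<^sub>+\<^sub>1\<close> the multiplier term and the proximal terms of the one-step
  estimate become differences of squared distances, up to the squared length of the step.
  The squares \<open>\<parallel>C d\<^sub>j\<^sub>+\<^sub>1\<parallel>\<^sup>2\<close> contained in the
  \<open>M\<close>-norm, and the residual term left by the multiplier update, absorb the cross term.\<close>
lemma potential_descent:
  assumes j: "j \<ge> 1"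
  shows "bet (j + 1) * (gap (y (j + 2)) (z (j + 2)) + l \<bullet> res (j + 2))
           \<le> potential l j - potential l (j + 1)"
proof -
  define a c where "a = bet j" and "c = bet (j + 1)"
  define r r' where "r = res (j + 1)" and "r' = res (j + 2)"
  define v where "v = C *v dz (j + 1)"
  define e e' where "e = z (j + 1) - zs" and "e' = z (j + 2) - zs"
  define h h' where "h = y (j + 1) - ys" and "h' = y (j + 2) - ys"
  define Gp where "Gp = gap (y (j + 2)) (z (j + 2)) + l \<bullet> r'"
  define SP SM where "SP = (P (j + 1) *v (h' - h)) \<bullet> h'" and "SM = (M *v dz (j + 1)) \<bullet> e'"
  have c: "c > 0" using bet_pos[of "j + 1"] by (simp add: c_def)
  have dz: "dz (j + 1) = e' - e" by (simp add: dz_def e_def e'_def)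
  have hh: "y (j + 1 + 1) - y (j + 1) = h' - h" by (simp add: h_def h'_def)
  have "Gp \<le> (l - lam (j + 1)) \<bullet> r' - c * (norm r')\<^sup>2 + c * (v \<bullet> r') - c * SM - SP
      - \<sigma>\<^sub>g / 2 * (norm e')\<^sup>2"
    using step_gap[of "j + 1" l, unfolded hh]
    by (simp add: Gp_def r'_def c_def v_def SM_def SP_def e'_def h'_def)
  then have "c * Gp \<le> c * ((l - lam (j + 1)) \<bullet> r' - c * (norm r')\<^sup>2 + c * (v \<bullet> r') - c * SM - SP
      - \<sigma>\<^sub>g / 2 * (norm e')\<^sup>2)"
    using c by (intro mult_left_mono) auto
  then have main: "c * Gp \<le> c * ((l - lam (j + 1)) \<bullet> r') - c\<^sup>2 * (norm r')\<^sup>2 + c\<^sup>2 * (v \<bullet> r')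
      - c\<^sup>2 * SM - c * SP - (c * \<sigma>\<^sub>g * (norm e')\<^sup>2) / 2"
    by (simp add: power2_eq_square algebra_simps)
  (* The square of the multiplier step is the residual term with factor gamma/2. *)
  have multiplier: "c * ((l - lam (j + 1)) \<bullet> r') =
      (norm (l - lam (j + 1)))\<^sup>2 / (2 * \<gamma>) - (norm (l - lam (j + 2)))\<^sup>2 / (2 * \<gamma>)
        + \<gamma> / 2 * (c\<^sup>2 * (norm r')\<^sup>2)"
  proof -
    have "l - lam (j + 2) = (l - lam (j + 1)) + (- (\<gamma> * c)) *\<^sub>R r'"
      using lam_step[of "j + 1"] by (simp add: c_def r'_def res_def)
    then have "(norm (l - lam (j + 2)))\<^sup>2 = (norm (l - lam (j + 1)))\<^sup>2
        + 2 * (- (\<gamma> * c)) * ((l - lam (j + 1)) \<bullet> r') + (- (\<gamma> * c))\<^sup>2 * (norm r')\<^sup>2"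
      by (simp only: norm_add_scaleR_squared)
    then show ?thesis using gamma by (simp add: field_simps power2_eq_square)
  qed
  have cross: "c\<^sup>2 * (v \<bullet> r') \<le> - ((\<gamma> - 1) * a * c * (r \<bullet> v))
      - (c\<^sup>2 * quad_form Q (dz (j + 1))) / 2 + (a\<^sup>2 * quad_form Q (dz j)) / 2"
    using cross_term_bound[OF j] by (simp add: a_def c_def v_def r_def r'_def)
  (* The golden ratio bound enters here, as the coefficient of the old residual. *)
  have young: "- 2 * ((\<gamma> - 1) * a * c * (r \<bullet> v)) \<le> (2 - \<gamma>) * a\<^sup>2 * (norm r)\<^sup>2 + c\<^sup>2 * (norm v)\<^sup>2"
  proof -
    have "0 \<le> (norm (c *\<^sub>R v + ((\<gamma> - 1) * a) *\<^sub>R r))\<^sup>2" by simp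
    also have "\<dots> = (norm (c *\<^sub>R v))\<^sup>2 + 2 * ((\<gamma> - 1) * a) * ((c *\<^sub>R v) \<bullet> r)
        + ((\<gamma> - 1) * a)\<^sup>2 * (norm r)\<^sup>2"
      by (rule norm_add_scaleR_squared)
    also have "\<dots> = c\<^sup>2 * (norm v)\<^sup>2 + 2 * ((\<gamma> - 1) * a * c * (r \<bullet> v))
        + (\<gamma> - 1)\<^sup>2 * (a\<^sup>2 * (norm r)\<^sup>2)"
      by (simp add: power_mult_distrib inner_commute)
    finally have "0 \<le> \<dots>" .
    moreover have "(\<gamma> - 1)\<^sup>2 * (a\<^sup>2 * (norm r)\<^sup>2) \<le> (2 - \<gamma>) * (a\<^sup>2 * (norm r)\<^sup>2)"
      by (intro mult_right_mono gamma_golden) simp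
    ultimately show ?thesis by (simp add: mult.assoc)
  qed
  have M_split: "c\<^sup>2 * quad_form M (dz (j + 1)) = c\<^sup>2 * (norm v)\<^sup>2 + c\<^sup>2 * quad_form Q (dz (j + 1))"
    by (simp add: M_def quad_form_add_matrix quad_form_gram v_def distrib_left)
  have Q_nonneg: "0 \<le> c\<^sup>2 * quad_form Q (dz (j + 1))"
    by (intro mult_nonneg_nonneg quad_form_nonneg Q) simp
  have z_prox: "2 * (c\<^sup>2 * SM) = c\<^sup>2 * quad_form M e' - c\<^sup>2 * quad_form M e + c\<^sup>2 * quad_form M (dz (j + 1))"
  proof -
    have "2 * SM = quad_form M e' - quad_form M e + quad_form M (dz (j + 1))"
      using three_point_identity[OF psd_symmetric[OF M_psd], of e' e 0]
      unfolding SM_def dz by simp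
    then have "c\<^sup>2 * (2 * SM) = c\<^sup>2 * (quad_form M e' - quad_form M e + quad_form M (dz (j + 1)))" by simp
    then show ?thesis by (simp add: algebra_simps)
  qed
  have y_prox: "c * quad_form (P (j + 1)) h' - c * quad_form (P (j + 1)) h \<le> 2 * (c * SP)"
  proof -
    have Pj: "psd (P (j + 1))" using P by simp
    have "2 * SP = quad_form (P (j + 1)) h' - quad_form (P (j + 1)) h + quad_form (P (j + 1)) (h' - h)"
      using three_point_identity[OF psd_symmetric[OF Pj], of h' h 0]
      unfolding SP_def by simp
    then have "quad_form (P (j + 1)) h' - quad_form (P (j + 1)) h \<le> 2 * SP"
      using quad_form_nonneg[OF Pj, of "h' - h"] by simp
    then have "c * (quad_form (P (j + 1)) h' - quad_form (P (j + 1)) h) \<le> c * (2 * SP)"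
      using c by (intro mult_left_mono) auto
    then show ?thesis by (simp add: algebra_simps)
  qed
  have P_next: "bet (j + 2) * quad_form (P (j + 2)) h' \<le> c * quad_form (P (j + 1)) h'"
    using loewner_le_quad_form[OF P_mono[of "j + 1"], of h']
    by (simp add: quad_form_scaleR_matrix c_def)
  have M_next: "(bet (j + 2))\<^sup>2 * quad_form M e' \<le> c\<^sup>2 * quad_form M e' + c * \<sigma>\<^sub>g * (norm e')\<^sup>2"
    using bet_squared_growth[of "j + 1" e'] by (simp add: c_def)
  have pot: "potential l j = (norm (l - lam (j + 1)))\<^sup>2 / (2 * \<gamma>)
      + (c * quad_form (P (j + 1)) h) / 2 + (c\<^sup>2 * quad_form M e) / 2
      + (a\<^sup>2 * quad_form Q (dz j)) / 2 + ((2 - \<gamma>) * a\<^sup>2 * (norm r)\<^sup>2) / 2"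
    by (simp add: potential_def a_def c_def e_def h_def r_def)
  have pot': "potential l (j + 1) = (norm (l - lam (j + 2)))\<^sup>2 / (2 * \<gamma>)
      + (bet (j + 2) * quad_form (P (j + 2)) h') / 2 + ((bet (j + 2))\<^sup>2 * quad_form M e') / 2
      + (c\<^sup>2 * quad_form Q (dz (j + 1))) / 2 + (c\<^sup>2 * (norm r')\<^sup>2 - \<gamma> / 2 * (c\<^sup>2 * (norm r')\<^sup>2))"
    by (simp add: potential_def c_def e'_def h'_def r'_def left_diff_distrib diff_divide_distrib)
  have "c * Gp \<le> potential l j - potential l (j + 1)"
    unfolding pot pot'
    using main multiplier cross young M_split Q_nonneg z_prox y_prox P_next M_next
    by linarith
  then show ?thesis by (simp add: c_def Gp_def r'_def)
qed

text \<open>The first step has no predecessor, so its term stays on the right-hand side.\<close>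
lemma weighted_gap_sum:
  assumes "k \<ge> 1"
  shows "(\<Sum>i=1..k. bet i * (gap (y (i + 1)) (z (i + 1)) + l \<bullet> res (i + 1)))
      \<le> bet 1 * (gap (y 2) (z 2) + l \<bullet> res 2) + potential l 1"
proof -
  have "(\<Sum>i=1..k. bet i * (gap (y (i + 1)) (z (i + 1)) + l \<bullet> res (i + 1))) + potential l k
      \<le> bet 1 * (gap (y 2) (z 2) + l \<bullet> res 2) + potential l 1"
    using assms
  proof (induction k rule: dec_induct)
    case base
    show ?case by (simp add: numeral_2_eq_2)
  next
    case (step n)
    then show ?case using potential_descent[of n l] by simp
  qed
  then show ?thesis using potential_nonneg[OF assms, of l] by linarith
qed

text \<open>The multiplier enters the right-hand side of the summed inequality only through
  \<open>l \<bullet> r\<^sub>2\<close> and \<open>\<parallel>l - \<lambda>\<^sub>2\<parallel>\<^sup>2\<close>, both bounded on balls. Uniformity is needed because \<open>l\<close> will be chosen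
  depending on the average.\<close>
lemma weighted_gap_uniform_bound:
  obtains K where "\<And>l k. norm l \<le> \<rho> \<Longrightarrow> k \<ge> 1 \<Longrightarrow>
    (\<Sum>i=1..k. bet i * (gap (y (i + 1)) (z (i + 1)) + l \<bullet> res (i + 1))) \<le> K"
proof -
  define K where "K = bet 1 * (gap (y 2) (z 2) + \<rho> * norm (res 2))
      + (potential 0 1 + ((\<rho> + norm (lam 2))\<^sup>2 - (norm (lam 2))\<^sup>2) / (2 * \<gamma>))"
  have "(\<Sum>i=1..k. bet i * (gap (y (i + 1)) (z (i + 1)) + l \<bullet> res (i + 1))) \<le> K"
    if l: "norm l \<le> \<rho>" and k: "k \<ge> 1" for l k
  proof -
    have "l \<bullet> res 2 \<le> \<rho> * norm (res 2)"
      using norm_cauchy_schwarz[of l "res 2"] l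
      by (meson mult_right_mono norm_ge_zero order_trans)
    then have "bet 1 * (gap (y 2) (z 2) + l \<bullet> res 2) \<le> bet 1 * (gap (y 2) (z 2) + \<rho> * norm (res 2))"
      using bet_pos[of 1] by (intro mult_left_mono) auto
    moreover have "potential l 1 \<le> potential 0 1 + ((\<rho> + norm (lam 2))\<^sup>2 - (norm (lam 2))\<^sup>2) / (2 * \<gamma>)"
    proof -
      have "norm (l - lam 2) \<le> \<rho> + norm (lam 2)"
        using norm_triangle_ineq4[of l "lam 2"] l by simp
      then have "(norm (l - lam 2))\<^sup>2 \<le> (\<rho> + norm (lam 2))\<^sup>2" by (intro power_mono) auto
      then have "(norm (l - lam 2))\<^sup>2 / (2 * \<gamma>) \<le> (\<rho> + norm (lam 2))\<^sup>2 / (2 * \<gamma>)"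
        using gamma by (intro divide_right_mono) auto
      then show ?thesis by (simp add: potential_def diff_divide_distrib numeral_2_eq_2)
    qed
    ultimately show ?thesis
      using weighted_gap_sum[OF k, of l] by (simp add: K_def)
  qed
  then show ?thesis using that by blast
qed

section \<open>Convergence of the averages\<close>

abbreviation "vy k \<equiv> ergodic_avg bet y k"
abbreviation "vz k \<equiv> ergodic_avg bet z k"

lemma penalty_sum_pos: "k \<ge> 1 \<Longrightarrow> 0 < penalty_sum bet k"
  unfolding penalty_sum_def using bet_pos by (intro sum_pos) auto

lemma averages_finite: "k \<ge> 1 \<Longrightarrow> f (vy k) \<noteq> \<infinity>" "k \<ge> 1 \<Longrightarrow> g (vz k) \<noteq> \<infinity>"
  using ergodic_avg_finite_jensen(1)[where u = y and w = bet, OF f_proper f_convex _ bet_pos f_finite]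
    ergodic_avg_finite_jensen(1)[where u = z and w = bet, OF g_proper g_convex _ bet_pos g_finite] by blast+

lemma gap_average_le:
  assumes k: "k \<ge> 1"
  shows "penalty_sum bet k * gap (vy k) (vz k) \<le> (\<Sum>i=1..k. bet i * gap (y (i + 1)) (z (i + 1)))"
proof -
  have "(\<Sum>i=1..k. bet i * gap (y (i + 1)) (z (i + 1))) =
      (\<Sum>i=1..k. bet i * \<phi> (y (i + 1))) + (\<Sum>i=1..k. bet i * \<psi> (z (i + 1)))
        - penalty_sum bet k * (\<phi> ys + \<psi> zs)"
    by (simp only: gap_def penalty_sum_def distrib_left right_diff_distrib sum.distrib
        sum_subtractf sum_distrib_right)
  moreover have "penalty_sum bet k * gap (vy k) (vz k) = penalty_sum bet k * \<phi> (vy k)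
      + penalty_sum bet k * \<psi> (vz k) - penalty_sum bet k * (\<phi> ys + \<psi> zs)"
    by (simp only: gap_def distrib_left right_diff_distrib)
  ultimately show ?thesis
    using ergodic_avg_finite_jensen(2)[where u = y and w = bet, OF f_proper f_convex k bet_pos f_finite]
      ergodic_avg_finite_jensen(2)[where u = z and w = bet, OF g_proper g_convex k bet_pos g_finite]
    by linarith
qed

lemma residual_average:
  assumes k: "k \<ge> 1"
  shows "penalty_sum bet k *\<^sub>R (B *v vy k + C *v vz k - b) = (\<Sum>i=1..k. bet i *\<^sub>R res (i + 1))"
proof -
  have "penalty_sum bet k \<noteq> 0" using penalty_sum_pos[OF k] by simp
  note avg = penalty_sum_scaleR_ergodic_avg[OF this]
  have "penalty_sum bet k *\<^sub>R (B *v vy k + C *v vz k - b)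
      = B *v (penalty_sum bet k *\<^sub>R vy k) + C *v (penalty_sum bet k *\<^sub>R vz k) - penalty_sum bet k *\<^sub>R b"
    by (simp add: matrix_vector_mult_scaleR scaleR_add_right scaleR_diff_right)
  also have "\<dots> = (\<Sum>i=1..k. bet i *\<^sub>R (B *v y (i + 1))) + (\<Sum>i=1..k. bet i *\<^sub>R (C *v z (i + 1)))
      - (\<Sum>i=1..k. bet i *\<^sub>R b)"
    unfolding avg linear_sum[OF matrix_vector_mul_linear]
    by (simp only: matrix_vector_mult_scaleR penalty_sum_def scaleR_sum_left)
  finally show ?thesis
    by (simp only: res_def scaleR_add_right scaleR_diff_right sum.distrib sum_subtractf)
qed

text \<open>Testing with \<open>l\<close> parallel to the residual of the average turns \<open>l \<bullet> r\<close> into \<open>\<rho> \<parallel>r\<parallel>\<close>. The choice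
  \<open>\<rho> = \<parallel>\<lambda>\<^sup>*\<parallel> + 1\<close> leaves one full copy of \<open>\<parallel>r\<parallel>\<close> after the lower bound on the gap has been used.\<close>
lemma ergodic_rate:
  obtains K where
    "\<And>k. k \<ge> 1 \<Longrightarrow> penalty_sum bet k * norm (B *v vy k + C *v vz k - b) \<le> K"
    "\<And>k. k \<ge> 1 \<Longrightarrow> penalty_sum bet k * \<bar>gap (vy k) (vz k)\<bar> \<le> (norm ls + 1) * K"
proof -
  define \<rho> where "\<rho> = norm ls + 1"
  obtain K where K: "\<And>l k. norm l \<le> \<rho> \<Longrightarrow> k \<ge> 1 \<Longrightarrow>
    (\<Sum>i=1..k. bet i * (gap (y (i + 1)) (z (i + 1)) + l \<bullet> res (i + 1))) \<le> K"
    using weighted_gap_uniform_bound[of \<rho>] by blast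
  have rate: "penalty_sum bet k * norm (B *v vy k + C *v vz k - b) \<le> K \<and>
      penalty_sum bet k * \<bar>gap (vy k) (vz k)\<bar> \<le> \<rho> * K" if k: "k \<ge> 1" for k
  proof -
    define S where "S = penalty_sum bet k"
    define R where "R = B *v vy k + C *v vz k - b"
    define G where "G = gap (vy k) (vz k)"
    have S: "S > 0" using penalty_sum_pos[OF k] by (simp add: S_def)
    define l where "l = \<rho> *\<^sub>R sgn R"
    have "norm l \<le> \<rho>" by (simp add: l_def norm_sgn \<rho>_def)
    have lR: "l \<bullet> R = \<rho> * norm R"
      by (cases "R = 0") (simp_all add: l_def sgn_div_norm power2_norm_eq_inner[symmetric] power2_eq_square)
    have "S * G + l \<bullet> (S *\<^sub>R R) \<le>
        (\<Sum>i=1..k. bet i * gap (y (i + 1)) (z (i + 1))) + l \<bullet> (\<Sum>i=1..k. bet i *\<^sub>R res (i + 1))"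
      using gap_average_le[OF k] residual_average[OF k] by (simp add: S_def G_def R_def)
    also have "\<dots> = (\<Sum>i=1..k. bet i * (gap (y (i + 1)) (z (i + 1)) + l \<bullet> res (i + 1)))"
      by (simp add: inner_sum_right sum.distrib[symmetric] distrib_left)
    also have "\<dots> \<le> K" using K \<open>norm l \<le> \<rho>\<close> k by blast
    finally have up: "S * G + \<rho> * (S * norm R) \<le> K" by (simp add: lR mult.left_commute)
    have "ls \<bullet> R \<le> norm ls * norm R" by (rule norm_cauchy_schwarz)
    then have "- (norm ls * norm R) \<le> G"
      using gap_lower_bound[OF averages_finite[OF k]] by (simp add: G_def R_def)
    then have "S * (- (norm ls * norm R)) \<le> S * G" using S by (intro mult_left_mono) auto
    then have low: "- (norm ls * (S * norm R)) \<le> S * G" by (simp add: mult.left_commute)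
    have nn: "0 \<le> S * norm R" using S by simp
    have 1: "S * norm R \<le> K" using up low by (simp add: \<rho>_def algebra_simps)
    have "norm ls * (S * norm R) \<le> norm ls * K" using 1 by (intro mult_left_mono) auto
    then have "- (\<rho> * K) \<le> S * G"
      using low 1 nn by (simp add: \<rho>_def distrib_right)
    moreover have "S * G \<le> \<rho> * K"
    proof -
      have "0 \<le> \<rho> * (S * norm R)" using nn by (simp add: \<rho>_def)
      moreover have "0 \<le> norm ls * K" using nn 1 by simp
      ultimately show ?thesis using up by (simp add: \<rho>_def distrib_right)
    qed
    ultimately have "\<bar>S * G\<bar> \<le> \<rho> * K" by simp
    then show ?thesis using 1 S by (simp add: S_def G_def R_def abs_mult)
  qed
  show ?thesis by (rule that[of K]) (use rate in \<open>auto simp: \<rho>_def\<close>)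
qed

lemma total_obj_gap:
  assumes k: "k \<ge> 1"
  shows "total_obj f g (ergodic_avg bet x k) - total_obj f g xs = ereal (gap (vy k) (vz k))"
proof -
  have "total_obj f g (ergodic_avg bet x k) = ereal (\<phi> (vy k) + \<psi> (vz k))"
    using real_part[OF f_proper averages_finite(1)[OF k]] real_part[OF g_proper averages_finite(2)[OF k]]
    by (simp add: total_obj_def fst_ergodic_avg snd_ergodic_avg) (metis plus_ereal.simps(1))
  moreover have "total_obj f g xs = ereal (\<phi> ys + \<psi> zs)"
    using real_part[OF f_proper solution_finite(1)] real_part[OF g_proper solution_finite(2)]
    by (simp add: total_obj_def) (metis plus_ereal.simps(1))
  ultimately show ?thesis by (simp add: gap_def)
qed

lemma bigo_inverse_penalty_sum:
  assumes "\<And>k. k \<ge> 1 \<Longrightarrow> penalty_sum bet k * h k \<le> K" and "\<And>k. k \<ge> 1 \<Longrightarrow> 0 \<le> h k"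
  shows "h \<in> O(\<lambda>k. 1 / penalty_sum bet k)"
proof (rule bigoI)
  show "\<forall>\<^sub>F k in sequentially. norm (h k) \<le> K * norm (1 / penalty_sum bet k)"
    using eventually_ge_at_top[of 1]
  proof eventually_elim
    case (elim k)
    then show ?case using assms[of k] penalty_sum_pos[of k] by (simp add: field_simps)
  qed
qed

end

theorem theorem3p3:
  fixes f :: "real^'n1 \<Rightarrow> ereal" and g :: "real^'n2 \<Rightarrow> ereal"
    and B :: "real^'n1^'m" and C :: "real^'n2^'m" and b :: "real^'m"
    and \<sigma>\<^sub>g \<gamma> \<epsilon> \<beta> \<tau> :: real
    and Q :: "real^'n2^'n2" and P :: "nat \<Rightarrow> real^'n1^'n1"
    and bet :: "nat \<Rightarrow> real"
    and x :: "nat \<Rightarrow> (real^'n1) \<times> (real^'n2)" and lam :: "nat \<Rightarrow> real^'m"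
    and xs :: "(real^'n1) \<times> (real^'n2)" and ls :: "real^'m"
  assumes f: "proper_fun f" "lsc_fun f" "convex_fun f"
    and g: "proper_fun g" "lsc_fun g" "convex_fun g"
    and sigma_nonneg: "\<sigma>\<^sub>g \<ge> 0"
    and sigma: "\<And>u w \<xi>. \<xi> \<in> subdifferential g w \<Longrightarrow>
                  g u - g w \<ge> ereal (\<xi> \<bullet> (u - w) + \<sigma>\<^sub>g / 2 * (norm (u - w))\<^sup>2)"
    and kkt: "kkt_solution f g B C b (fst xs) (snd xs) ls"
    and gamma: "1 < \<gamma>" "\<gamma> < (1 + sqrt 5) / 2"
    and eps: "0 < \<epsilon>" "\<epsilon> < 1"
    and beta: "0 < \<beta>" "\<beta> < 1"
    and tau: "0 < \<tau>" "\<tau> < 1"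
    and Q: "psd Q"
    and P: "\<And>k. k \<ge> 1 \<Longrightarrow> psd (P k)"
    and P_mono: "\<And>k. k \<ge> 1 \<Longrightarrow> loewner_le (bet (k + 1) *\<^sub>R P (k + 1)) (bet k *\<^sub>R P k)"
    and lmax_pos: "lambda_max (transpose C ** C + Q) > 0"
    and bet_init: "bet 1 \<ge> \<beta>"
    and y_step: "\<And>k. k \<ge> 1 \<Longrightarrow>
          is_arg_min (y_obj f B C b (bet k) (P k) (fst (x k)) (snd (x k)) (lam k))
            (\<lambda>_. True) (fst (x (k + 1)))"
    and z_step: "\<And>k. k \<ge> 1 \<Longrightarrow>
          is_arg_min (z_obj g B C b (bet k) (bet k *\<^sub>R Q) (fst (x (k + 1))) (snd (x k)) (lam k))
            (\<lambda>_. True) (snd (x (k + 1)))"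
    and lam_step: "\<And>k. k \<ge> 1 \<Longrightarrow>
          lam (k + 1) = lam k + (\<gamma> * bet k) *\<^sub>R (B *v fst (x (k + 1)) + C *v snd (x (k + 1)) - b)"
    and bet_step: "\<And>k. k \<ge> 1 \<Longrightarrow>
          bet (k + 1) \<in> {max \<beta> (\<tau> * bet k) ..
            sqrt ((bet k)\<^sup>2 + (1 - \<epsilon>) * \<sigma>\<^sub>g * bet k / lambda_max (transpose C ** C + Q))}"
  shows "(\<forall>\<^sub>F k in sequentially.
            \<bar>total_obj f g (ergodic_avg bet x k) - total_obj f g xs\<bar> \<noteq> \<infinity>) \<and>
         (\<lambda>k. real_of_ereal \<bar>total_obj f g (ergodic_avg bet x k) - total_obj f g xs\<bar>)
            \<in> O(\<lambda>k. 1 / penalty_sum bet k) \<and>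
         (\<lambda>k. norm (constr_map B C (ergodic_avg bet x k) - b))
            \<in> O(\<lambda>k. 1 / penalty_sum bet k)"
proof -
  have bet_step': "\<beta> \<le> bet (k + 1) \<and>
      bet (k + 1) \<le> sqrt ((bet k)\<^sup>2 + (1 - \<epsilon>) * \<sigma>\<^sub>g * bet k / lambda_max (transpose C ** C + Q))"
    if "k \<ge> 1" for k
    using bet_step[OF that] by simp
  interpret iadmm f g B C b \<sigma>\<^sub>g \<gamma> \<epsilon> \<beta> Q P bet x lam xs ls
    by (rule iadmm.intro) (fact f g sigma_nonneg sigma kkt gamma eps beta Q P P_mono lmax_pos
        bet_init y_step z_step lam_step bet_step')+
  obtain K where feas: "\<And>k. k \<ge> 1 \<Longrightarrow> penalty_sum bet k * norm (B *v vy k + C *v vz k - b) \<le> K"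
    and obj: "\<And>k. k \<ge> 1 \<Longrightarrow> penalty_sum bet k * \<bar>gap (vy k) (vz k)\<bar> \<le> (norm ls + 1) * K"
    using ergodic_rate by blast
  show ?thesis
  proof (intro conjI)
    show "\<forall>\<^sub>F k in sequentially. \<bar>total_obj f g (ergodic_avg bet x k) - total_obj f g xs\<bar> \<noteq> \<infinity>"
      using eventually_ge_at_top[of 1] by eventually_elim (simp add: total_obj_gap)
    show "(\<lambda>k. real_of_ereal \<bar>total_obj f g (ergodic_avg bet x k) - total_obj f g xs\<bar>)
        \<in> O(\<lambda>k. 1 / penalty_sum bet k)"
      by (rule bigo_inverse_penalty_sum[where K = "(norm ls + 1) * K"])
         (use obj in \<open>simp_all add: total_obj_gap\<close>)
    show "(\<lambda>k. norm (constr_map B C (ergodic_avg bet x k) - b)) \<in> O(\<lambda>k. 1 / penalty_sum bet k)"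
      by (rule bigo_inverse_penalty_sum[where K = K])
         (use feas in \<open>simp_all add: constr_map_def fst_ergodic_avg snd_ergodic_avg\<close>)
  qed
qed

end
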